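(* If a $(v,k,\lambda)$-BIBD admits a $0$-LSE $\ell$-colouring with $\ell<v$, then $3\leq \ell\leq k$.
   Context: For positive integers $v,k,\lambda$ with $2\le k<v$, a $(v,k,\lambda)$-BIBD is a pair $(V,\mathcal{B})$ where $V$ is a set of $v$ points and $\mathcal{B}$ is a collection of $k$-element subsets of $V$ (blocks) such that every pair of distinct points lies in exactly $\lambda$ blocks. An $\ell$-colouring is a surjective map from $V$ onto a set of $\ell$ colours; the colour class of a colour is the set of points mapped to it. A $0$-LSE $\ell$-colouring is an $\ell$-colouring such that in each block $B$, some colour does not appear in $B$, and for any two colours other than that colour, with colour classes $C_1,C_2$, $\big||C_1\cap B|-|C_2\cap B|\big|\le 1$. Such a colouring is called nontrivial if $\ell<v$. *)

theory Defs
  imports "HOL-Library.Multiset"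
begin

text \<open>The blocks form a multiset, so that repeated blocks are allowed and are counted with
  multiplicity in the number of blocks through a pair of points.\<close>

definition bibd :: "'a set \<Rightarrow> 'a set multiset \<Rightarrow> nat \<Rightarrow> nat \<Rightarrow> nat \<Rightarrow> bool" where
  "bibd V \<B> v k \<Lambda> \<longleftrightarrow>
     2 \<le> k \<and> k < v \<and> 0 < \<Lambda> \<and>
     finite V \<and> card V = v \<and>
     (\<forall>B \<in># \<B>. B \<subseteq> V \<and> card B = k) \<and>
     (\<forall>x \<in> V. \<forall>y \<in> V. x \<noteq> y \<longrightarrow> size {#B \<in># \<B>. x \<in> B \<and> y \<in> B#} = \<Lambda>)"

definition colouring :: "'a set \<Rightarrow> 'c set \<Rightarrow> nat \<Rightarrow> ('a \<Rightarrow> 'c) \<Rightarrow> bool" where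
  "colouring V C l f \<longleftrightarrow> finite C \<and> card C = l \<and> f ` V = C"

definition colour_class :: "'a set \<Rightarrow> ('a \<Rightarrow> 'c) \<Rightarrow> 'c \<Rightarrow> 'a set" where
  "colour_class V f c = {x \<in> V. f x = c}"

text \<open>The absent colour \<open>c\<close> may depend on the block. The cardinalities are compared as
  integers because subtraction on the natural numbers truncates.\<close>

definition zero_lse_colouring ::
    "'a set \<Rightarrow> 'a set multiset \<Rightarrow> 'c set \<Rightarrow> nat \<Rightarrow> ('a \<Rightarrow> 'c) \<Rightarrow> bool" where
  "zero_lse_colouring V \<B> C l f \<longleftrightarrow>
     colouring V C l f \<and>
     (\<forall>B \<in># \<B>. \<exists>c \<in> C.
        colour_class V f c \<inter> B = {} \<and>
        (\<forall>c1 \<in> C - {c}. \<forall>c2 \<in> C - {c}.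
           \<bar>int (card (colour_class V f c1 \<inter> B)) - int (card (colour_class V f c2 \<inter> B))\<bar> \<le> 1))"

end

theory Submission
  imports Defs
begin

text \<open>A block through two points of different colours also misses a third colour, so
  \<open>3 \<le> l\<close>. Since \<open>l < v\<close>, two points share a colour; a block \<open>B\<close> through both has a colour of
  multiplicity at least 2, so by balance every colour but the absent one occurs in \<open>B\<close>. As
  two points of \<open>B\<close> share a colour, \<open>l - 1 < k\<close>.\<close>

text \<open>The blocks through both points number \<open>\<Lambda>\<close>, counted with
  multiplicity, and \<open>\<Lambda>\<close> is positive.\<close>

lemma bibd_block_through:
  assumes "bibd V \<B> v k \<Lambda>" "x \<in> V" "y \<in> V" "x \<noteq> y"
  obtains B where "B \<in># \<B>" "x \<in> B" "y \<in> B"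
proof -
  have "size {#B \<in># \<B>. x \<in> B \<and> y \<in> B#} > 0"
    using assms unfolding bibd_def by auto
  then have "{#B \<in># \<B>. x \<in> B \<and> y \<in> B#} \<noteq> {#}"
    by (simp only: nonempty_has_size)
  then obtain B where "B \<in># {#B \<in># \<B>. x \<in> B \<and> y \<in> B#}"
    by (rule multiset_nonemptyE)
  then show thesis
    by (intro that) auto
qed

lemma zero_lse_absent_colour:
  assumes "bibd V \<B> v k \<Lambda>" "zero_lse_colouring V \<B> C l f" "B \<in># \<B>"
  obtains c where "c \<in> C" "f ` B \<subseteq> C - {c}"
    "\<forall>c1 \<in> C - {c}. \<forall>c2 \<in> C - {c}.
      card (colour_class V f c1 \<inter> B) \<le> card (colour_class V f c2 \<inter> B) + 1"
proof -
  have "B \<subseteq> V" "f ` V = C"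
    using assms unfolding bibd_def zero_lse_colouring_def colouring_def by auto
  moreover obtain c where c: "c \<in> C" "colour_class V f c \<inter> B = {}"
    "\<forall>c1 \<in> C - {c}. \<forall>c2 \<in> C - {c}.
      \<bar>int (card (colour_class V f c1 \<inter> B)) - int (card (colour_class V f c2 \<inter> B))\<bar> \<le> 1"
    using assms(2,3) unfolding zero_lse_colouring_def by blast
  ultimately have "f ` B \<subseteq> C - {c}"
    unfolding colour_class_def by auto
  moreover have "\<forall>c1 \<in> C - {c}. \<forall>c2 \<in> C - {c}.
      card (colour_class V f c1 \<inter> B) \<le> card (colour_class V f c2 \<inter> B) + 1"
  proof (intro ballI)
    fix c1 c2 assume "c1 \<in> C - {c}" "c2 \<in> C - {c}"
    then have "\<bar>int (card (colour_class V f c1 \<inter> B)) - int (card (colour_class V f c2 \<inter> B))\<bar> \<le> 1"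
      using c(3) by blast
    then show "card (colour_class V f c1 \<inter> B) \<le> card (colour_class V f c2 \<inter> B) + 1"
      by linarith
  qed
  ultimately show thesis
    by (rule that[OF c(1)])
qed

lemma zero_lse_colouring_ge_3:
  assumes "bibd V \<B> v k \<Lambda>" "zero_lse_colouring V \<B> C l f"
  shows "3 \<le> l"
proof -
  have fin: "finite C" and l: "card C = l" and im: "f ` V = C"
    using assms(2) unfolding zero_lse_colouring_def colouring_def by auto
  have "finite V" "1 < card V"
    using assms(1) unfolding bibd_def by auto
  then obtain x y where xy: "x \<in> V" "y \<in> V" "x \<noteq> y"
    using card_le_Suc0_iff_eq[of V] by auto
  \<comment> \<open>The colour absent from a block through \<open>x\<close> is still attained
    somewhere in \<open>V\<close>, as \<open>f\<close> is onto \<open>C\<close>; any point of that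
    colour serves as \<open>z\<close>. The point \<open>y\<close> only supplies such a
    block.\<close>
  obtain z where z: "z \<in> V" "f z \<noteq> f x"
  proof -
    obtain B where B: "B \<in># \<B>" "x \<in> B" "y \<in> B"
      using bibd_block_through[OF assms(1) xy] .
    obtain c where "c \<in> C" "f ` B \<subseteq> C - {c}"
      by (rule zero_lse_absent_colour[OF assms B(1)]) (rule that)
    then show thesis
      using B(2) im that by blast
  qed
  then obtain B where B: "B \<in># \<B>" "x \<in> B" "z \<in> B"
    using bibd_block_through[OF assms(1) xy(1) z(1)] z(2) by blast
  obtain c where "c \<in> C" "f ` B \<subseteq> C - {c}"
    by (rule zero_lse_absent_colour[OF assms B(1)]) (rule that)
  \<comment> \<open>Both \<open>f x\<close> and \<open>f z\<close> occur in \<open>B\<close> while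
    \<open>c\<close> does not, so these are three distinct colours.\<close>
  then have "card {f x, f z, c} \<le> card C" "c \<noteq> f x" "c \<noteq> f z"
    using B by (auto intro!: card_mono[OF fin])
  with z l show ?thesis
    by auto
qed

lemma zero_lse_colouring_le_block_size:
  assumes "bibd V \<B> v k \<Lambda>" "zero_lse_colouring V \<B> C l f" "l < v"
  shows "l \<le> k"
proof -
  have l: "finite C" "card C = l" and im: "f ` V = C"
    using assms(2) unfolding zero_lse_colouring_def colouring_def by auto
  have "finite V" and v: "card V = v"
    using assms(1) unfolding bibd_def by auto
  \<comment> \<open>Pigeonhole: an injective \<open>f\<close> would give
    \<open>l = v\<close>.\<close>
  have "\<not> inj_on f V"
    using card_image[of f V] im l v assms(3) by auto
  then obtain x y where xy: "x \<in> V" "y \<in> V" "x \<noteq> y" "f x = f y"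
    by (auto simp: inj_on_def)
  obtain B where B: "B \<in># \<B>" "x \<in> B" "y \<in> B"
    using bibd_block_through[OF assms(1) xy(1-3)] .
  have k: "card B = k" and finB: "finite B"
    using assms(1) B(1) \<open>finite V\<close> unfolding bibd_def by (auto intro: finite_subset)
  obtain c where c: "c \<in> C" "f ` B \<subseteq> C - {c}"
    "\<forall>c1 \<in> C - {c}. \<forall>c2 \<in> C - {c}.
      card (colour_class V f c1 \<inter> B) \<le> card (colour_class V f c2 \<inter> B) + 1"
    using zero_lse_absent_colour[OF assms(1,2) B(1)] .
  have "card {x, y} \<le> card (colour_class V f (f x) \<inter> B)"
    using xy B finB by (intro card_mono) (auto simp: colour_class_def)
  then have two: "2 \<le> card (colour_class V f (f x) \<inter> B)"
    using xy(3) by simp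
  have "C - {c} \<subseteq> f ` B"
  proof
    fix d assume "d \<in> C - {c}"
    moreover have "f x \<in> C - {c}"
      using c(2) B(2) by blast
    ultimately have "card (colour_class V f (f x) \<inter> B) \<le> card (colour_class V f d \<inter> B) + 1"
      using c(3) by blast
    \<comment> \<open>The multiplicity 2 just exceeds the tolerance 1 of the balance condition, so
      multiplicity 0 is excluded for \<open>d\<close>.\<close>
    then have "card (colour_class V f d \<inter> B) \<noteq> 0"
      using two by linarith
    then have "colour_class V f d \<inter> B \<noteq> {}"
      by auto
    then show "d \<in> f ` B"
      unfolding colour_class_def by blast
  qed
  then have "card (C - {c}) \<le> card (f ` B)"
    using finB by (intro card_mono) auto
  moreover have "\<not> inj_on f B"
    using xy B by (auto simp: inj_on_def)
  then have "card (f ` B) < card B"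
    using card_image_le[OF finB] eq_card_imp_inj_on[OF finB] by (auto simp: le_less)
  ultimately show ?thesis
    using l c(1) k by simp
qed

theorem theorem3p3:
  fixes V :: "'a set" and \<B> :: "'a set multiset" and v k \<Lambda> l :: nat
    and C :: "'c set" and f :: "'a \<Rightarrow> 'c"
  assumes "bibd V \<B> v k \<Lambda>"
    and "zero_lse_colouring V \<B> C l f"
    and "l < v"
  shows "3 \<le> l \<and> l \<le> k"
  using zero_lse_colouring_ge_3[OF assms(1,2)] zero_lse_colouring_le_block_size[OF assms] ..

end
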